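(* Let $A$ be a commutative ring and $\mathfrak{a} \subseteq A$ a finitely generated ideal. Let $\{M_i\}_{i \in I}$ be an inverse system of $A$-modules, indexed by a directed set $(I, \leq)$. Assume every $M_i$ is an $\mathfrak{a}$-adically complete module. Define the $A$-module $M := \varprojlim_{i} M_i$. Then $M$ is $\mathfrak{a}$-adically complete.
   Context: No noetherian hypothesis on $A$ is made; $I$ need not be countable. A directed set $(I,\leq)$ is a quasi-ordered set in which any two elements have an upper bound; an inverse system has transition maps $M_j \to M_i$ for $i \leq j$. An $A$-module $N$ is called $\mathfrak{a}$-adically complete if the canonical homomorphism $N \to \varprojlim_{j \in \mathbb{N}} N/\mathfrak{a}^j \cdot N$ is an isomorphism (so completeness includes separatedness). *)

theory Defs
  imports "HOL-Algebra.Module" "HOL-Algebra.Ideal_Product"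
begin

definition mod_hom ::
  "('a, 'r) ring_scheme \<Rightarrow> ('a, 'm, 'x) module_scheme \<Rightarrow> ('a, 'n, 'y) module_scheme \<Rightarrow> ('m \<Rightarrow> 'n) set"
  where "mod_hom R M N =
    {h \<in> hom (add_monoid M) (add_monoid N).
       \<forall>a\<in>carrier R. \<forall>x\<in>carrier M. h (a \<odot>\<^bsub>M\<^esub> x) = a \<odot>\<^bsub>N\<^esub> h x}"

definition mod_iso ::
  "('a, 'r) ring_scheme \<Rightarrow> ('a, 'm, 'x) module_scheme \<Rightarrow> ('a, 'n, 'y) module_scheme \<Rightarrow> ('m \<Rightarrow> 'n) set"
  where "mod_iso R M N = {h \<in> mod_hom R M N. bij_betw h (carrier M) (carrier N)}"


text \<open>The \<^const>\<open>mult\<close> and \<^const>\<open>one\<close> fields that a module record inherits from the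
  ring record are not part of the module structure; below they are left unspecified.\<close>

definition quot_module ::
  "('a, 'm, 'x) module_scheme \<Rightarrow> 'm set \<Rightarrow> ('a, 'm set) module"
  where "quot_module M H =
    \<lparr>carrier = a_rcosets\<^bsub>M\<^esub> H, mult = undefined, one = undefined,
     zero = H, add = set_add M,
     smult = (\<lambda>a X. \<Union>x\<in>X. H +>\<^bsub>M\<^esub> (a \<odot>\<^bsub>M\<^esub> x))\<rparr>"


text \<open>The index set may be empty; \<open>(i, j) \<in> r\<close> means \<open>i \<le> j\<close>.\<close>

locale directed_set =
  fixes I :: "'i set" and r :: "('i \<times> 'i) set"
  assumes preorder: "preorder_on I r"
    and upper_bound: "\<lbrakk>i \<in> I; j \<in> I\<rbrakk> \<Longrightarrow> \<exists>k\<in>I. (i, k) \<in> r \<and> (j, k) \<in> r"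

text \<open>For \<open>(i, j) \<in> r\<close>, the transition map \<open>f i j\<close> goes from \<open>M j\<close> to \<open>M i\<close>.\<close>

locale inverse_system =
  fixes R :: "('a, 'r) ring_scheme" and I :: "'i set" and r :: "('i \<times> 'i) set"
    and M :: "'i \<Rightarrow> ('a, 'm, 'x) module_scheme" and f :: "'i \<Rightarrow> 'i \<Rightarrow> 'm \<Rightarrow> 'm"
  assumes modules: "i \<in> I \<Longrightarrow> module R (M i)"
    and transition_hom: "\<lbrakk>i \<in> I; j \<in> I; (i, j) \<in> r\<rbrakk> \<Longrightarrow> f i j \<in> mod_hom R (M j) (M i)"
    and transition_id: "\<lbrakk>i \<in> I; x \<in> carrier (M i)\<rbrakk> \<Longrightarrow> f i i x = x"
    and transition_comp:
      "\<lbrakk>i \<in> I; j \<in> I; k \<in> I; (i, j) \<in> r; (j, k) \<in> r; x \<in> carrier (M k)\<rbrakk>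
        \<Longrightarrow> f i j (f j k x) = f i k x"

definition inverse_limit ::
  "'i set \<Rightarrow> ('i \<times> 'i) set \<Rightarrow> ('i \<Rightarrow> ('a, 'm, 'x) module_scheme) \<Rightarrow> ('i \<Rightarrow> 'i \<Rightarrow> 'm \<Rightarrow> 'm)
    \<Rightarrow> ('a, 'i \<Rightarrow> 'm) module"
  where "inverse_limit I r M f =
    \<lparr>carrier = {x \<in> (\<Pi>\<^sub>E i\<in>I. carrier (M i)).
                  \<forall>i\<in>I. \<forall>j\<in>I. (i, j) \<in> r \<longrightarrow> f i j (x j) = x i},
     mult = undefined, one = undefined,
     zero = (\<lambda>i\<in>I. \<zero>\<^bsub>M i\<^esub>),
     add = (\<lambda>x y. \<lambda>i\<in>I. x i \<oplus>\<^bsub>M i\<^esub> y i),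
     smult = (\<lambda>a x. \<lambda>i\<in>I. a \<odot>\<^bsub>M i\<^esub> x i)\<rparr>"


definition finitely_generated_ideal :: "('a, 'r) ring_scheme \<Rightarrow> 'a set \<Rightarrow> bool"
  where "finitely_generated_ideal R \<aa> \<longleftrightarrow>
    (\<exists>S. finite S \<and> S \<subseteq> carrier R \<and> \<aa> = Idl\<^bsub>R\<^esub> S)"

text \<open>The submodule \<open>\<aa> \<cdot> M\<close> of finite sums of products, as in \<^const>\<open>ideal_prod\<close>.\<close>

inductive_set ideal_smult :: "('a, 'm, 'x) module_scheme \<Rightarrow> 'a set \<Rightarrow> 'm set"
  for M and \<aa> where
    smult: "\<lbrakk>a \<in> \<aa>; x \<in> carrier M\<rbrakk> \<Longrightarrow> a \<odot>\<^bsub>M\<^esub> x \<in> ideal_smult M \<aa>"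
  | sum: "\<lbrakk>x \<in> ideal_smult M \<aa>; y \<in> ideal_smult M \<aa>\<rbrakk> \<Longrightarrow> x \<oplus>\<^bsub>M\<^esub> y \<in> ideal_smult M \<aa>"

text \<open>The submodule \<open>\<aa>\<^sup>n \<cdot> M\<close>. Multiplication in \<^const>\<open>ideals_set\<close> is the product of
  ideals and its unit is \<^term>\<open>carrier R\<close>, so that \<open>\<aa>\<^sup>0 = R\<close>.\<close>

definition adic_submodule ::
  "('a, 'r) ring_scheme \<Rightarrow> 'a set \<Rightarrow> ('a, 'm, 'x) module_scheme \<Rightarrow> nat \<Rightarrow> 'm set"
  where "adic_submodule R \<aa> M n = ideal_smult M (\<aa> [^]\<^bsub>ideals_set R\<^esub> n)"

definition adic_quot ::
  "('a, 'r) ring_scheme \<Rightarrow> 'a set \<Rightarrow> ('a, 'm, 'x) module_scheme \<Rightarrow> nat \<Rightarrow> ('a, 'm set) module"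
  where "adic_quot R \<aa> M n = quot_module M (adic_submodule R \<aa> M n)"

text \<open>The projection \<open>M / \<aa>\<^sup>n M \<rightarrow> M / \<aa>\<^sup>m M\<close> for \<open>m \<le> n\<close>, sending \<open>x + \<aa>\<^sup>n M\<close> to
  \<open>x + \<aa>\<^sup>n M + \<aa>\<^sup>m M = x + \<aa>\<^sup>m M\<close>.\<close>

definition adic_proj ::
  "('a, 'r) ring_scheme \<Rightarrow> 'a set \<Rightarrow> ('a, 'm, 'x) module_scheme \<Rightarrow> nat \<Rightarrow> nat \<Rightarrow> 'm set \<Rightarrow> 'm set"
  where "adic_proj R \<aa> M m n X = set_add M (adic_submodule R \<aa> M m) X"

definition adic_completion ::
  "('a, 'r) ring_scheme \<Rightarrow> 'a set \<Rightarrow> ('a, 'm, 'x) module_scheme \<Rightarrow> ('a, nat \<Rightarrow> 'm set) module"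
  where "adic_completion R \<aa> M =
    inverse_limit UNIV {(m, n). m \<le> n} (adic_quot R \<aa> M) (adic_proj R \<aa> M)"

definition adic_canonical ::
  "('a, 'r) ring_scheme \<Rightarrow> 'a set \<Rightarrow> ('a, 'm, 'x) module_scheme \<Rightarrow> 'm \<Rightarrow> nat \<Rightarrow> 'm set"
  where "adic_canonical R \<aa> M x = (\<lambda>n. adic_submodule R \<aa> M n +>\<^bsub>M\<^esub> x)"

definition adically_complete ::
  "('a, 'r) ring_scheme \<Rightarrow> 'a set \<Rightarrow> ('a, 'm, 'x) module_scheme \<Rightarrow> bool"
  where "adically_complete R \<aa> M \<longleftrightarrow>
    module R M \<and> adic_canonical R \<aa> M \<in> mod_iso R M (adic_completion R \<aa> M)"

end

theory Submission
  imports Defs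
begin

text \<open>A module is \<open>\<aa>\<close>-adically complete iff it is separated and every series \<open>\<Sum>y\<^sub>n\<close> with
  \<open>y\<^sub>n \<in> \<aa>\<^sup>n M\<close> converges. In a limit \<open>L\<close> of complete modules such a series has a unique
  componentwise sum, but a priori it converges only for the topology induced by the product, which
  may be coarser than the \<open>\<aa>\<close>-adic one. Finite generation closes the gap: the tails of the
  series lie in \<open>\<aa>\<^sup>k L\<close>, because by induction on \<open>k\<close> the componentwise sum \<open>s\<close> of any series
  with \<open>y\<^sub>n \<in> \<aa>\<^bsup>k+n\<^esup> L\<close> does. In the step, \<open>\<aa> = (g\<^sub>1, \<dots>, g\<^sub>d)\<close> allows one to write
  \<open>y\<^sub>n = g\<^sub>1 z\<^sub>1\<^sub>n + \<dots> + g\<^sub>d z\<^sub>d\<^sub>n\<close> with \<open>z\<^sub>l\<^sub>n \<in> \<aa>\<^bsup>k+n\<^esup> L\<close>, so that \<open>s\<close> is the sum of the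
  \<open>g\<^sub>l t\<^sub>l\<close>, where \<open>t\<^sub>l \<in> \<aa>\<^sup>k L\<close> is the componentwise sum of the \<open>z\<^sub>l\<^sub>n\<close>.\<close>

section \<open>Module homomorphisms and submodules\<close>

lemma mod_homD:
  assumes "h \<in> mod_hom R M N"
  shows "x \<in> carrier M \<Longrightarrow> h x \<in> carrier N"
    and "\<lbrakk>x \<in> carrier M; y \<in> carrier M\<rbrakk> \<Longrightarrow> h (x \<oplus>\<^bsub>M\<^esub> y) = h x \<oplus>\<^bsub>N\<^esub> h y"
    and "\<lbrakk>a \<in> carrier R; x \<in> carrier M\<rbrakk> \<Longrightarrow> h (a \<odot>\<^bsub>M\<^esub> x) = a \<odot>\<^bsub>N\<^esub> h x"
  using assms by (auto simp: mod_hom_def hom_def)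

lemma mod_homI:
  assumes "\<And>x. x \<in> carrier M \<Longrightarrow> h x \<in> carrier N"
    and "\<And>x y. \<lbrakk>x \<in> carrier M; y \<in> carrier M\<rbrakk> \<Longrightarrow> h (x \<oplus>\<^bsub>M\<^esub> y) = h x \<oplus>\<^bsub>N\<^esub> h y"
    and "\<And>a x. \<lbrakk>a \<in> carrier R; x \<in> carrier M\<rbrakk> \<Longrightarrow> h (a \<odot>\<^bsub>M\<^esub> x) = a \<odot>\<^bsub>N\<^esub> h x"
  shows "h \<in> mod_hom R M N"
  using assms by (auto simp: mod_hom_def hom_def)

lemma mod_hom_zero:
  assumes "module R M" "module R N" "h \<in> mod_hom R M N"
  shows "h \<zero>\<^bsub>M\<^esub> = \<zero>\<^bsub>N\<^esub>"
proof -
  interpret M: module R M by fact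
  interpret N: module R N by fact
  have "h \<zero>\<^bsub>M\<^esub> = h (\<zero>\<^bsub>R\<^esub> \<odot>\<^bsub>M\<^esub> \<zero>\<^bsub>M\<^esub>)"
    by simp
  also have "\<dots> = \<zero>\<^bsub>R\<^esub> \<odot>\<^bsub>N\<^esub> h \<zero>\<^bsub>M\<^esub>"
    by (rule mod_homD(3)[OF assms(3)]) simp_all
  also have "\<dots> = \<zero>\<^bsub>N\<^esub>"
    by (rule N.smult_l_null) (simp add: mod_homD(1)[OF assms(3)])
  finally show ?thesis .
qed

lemma mod_hom_minus:
  assumes "module R M" "module R N" "h \<in> mod_hom R M N" "x \<in> carrier M"
  shows "h (\<ominus>\<^bsub>M\<^esub> x) = \<ominus>\<^bsub>N\<^esub> h x"
proof -
  interpret M: module R M by fact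
  interpret N: module R N by fact
  have "h ((\<ominus>\<^bsub>R\<^esub> \<one>\<^bsub>R\<^esub>) \<odot>\<^bsub>M\<^esub> x) = (\<ominus>\<^bsub>R\<^esub> \<one>\<^bsub>R\<^esub>) \<odot>\<^bsub>N\<^esub> h x"
    by (simp add: mod_homD[OF assms(3)] assms(4))
  then show ?thesis
    by (simp add: mod_homD[OF assms(3)] assms(4) M.smult_l_minus N.smult_l_minus)
qed

lemma mod_hom_diff:
  assumes "module R M" "module R N" "h \<in> mod_hom R M N" "x \<in> carrier M" "y \<in> carrier M"
  shows "h (x \<ominus>\<^bsub>M\<^esub> y) = h x \<ominus>\<^bsub>N\<^esub> h y"
proof -
  interpret M: module R M by fact
  interpret N: module R N by fact
  show ?thesis
    using assms(4,5)
    by (simp add: a_minus_def mod_homD[OF assms(3)] mod_hom_minus[OF assms(1-3)])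
qed

lemma ideal_smult_image:
  assumes "h \<in> mod_hom R M N" "\<aa> \<subseteq> carrier R" "module R M" "x \<in> ideal_smult M \<aa>"
  shows "h x \<in> ideal_smult N \<aa>"
proof -
  interpret module R M by fact
  have "x \<in> carrier M \<and> h x \<in> ideal_smult N \<aa>"
    using assms(4)
  proof induction
    case (smult a x)
    then show ?case
      using assms(2) by (auto simp: subset_iff mod_homD[OF assms(1)] intro!: ideal_smult.smult)
  next
    case (sum x y)
    then show ?case
      by (auto simp: mod_homD[OF assms(1)] intro!: ideal_smult.sum)
  qed
  then show ?thesis ..
qed

section \<open>Partial sums of series, and multiples of a submodule by a list of scalars\<close>

primrec partial_sum :: "('a, 'm, 'x) module_scheme \<Rightarrow> (nat \<Rightarrow> 'm) \<Rightarrow> nat \<Rightarrow> 'm"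
  where
    "partial_sum M y 0 = \<zero>\<^bsub>M\<^esub>"
  | "partial_sum M y (Suc n) = partial_sum M y n \<oplus>\<^bsub>M\<^esub> y n"

text \<open>\<open>partial_sum M y n\<close> has the n terms \<open>y 0\<close>, ...,
  \<open>y (n - 1)\<close>, and the remainder after them must lie in \<aa>^n M for this same n. When
  every \<open>y n\<close> lies in \<aa>^n M, this amounts to convergence to \<open>s\<close> in the
  \<aa>-adic topology.\<close>

definition adic_sums ::
  "('a, 'r) ring_scheme \<Rightarrow> 'a set \<Rightarrow> ('a, 'm, 'x) module_scheme \<Rightarrow> (nat \<Rightarrow> 'm) \<Rightarrow> 'm \<Rightarrow> bool"
  where "adic_sums R \<aa> M y s \<longleftrightarrow>
    s \<in> carrier M \<and> (\<forall>n. s \<ominus>\<^bsub>M\<^esub> partial_sum M y n \<in> adic_submodule R \<aa> M n)"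

text \<open>For gs = [g_1, ..., g_d] this is g_1 H + ... + g_d H. Recursion on a list lets the
  generators be split off one at a time, without sums over an index set.\<close>

primrec list_smult :: "('a, 'm, 'x) module_scheme \<Rightarrow> 'm set \<Rightarrow> 'a list \<Rightarrow> 'm set"
  where
    "list_smult M H [] = {\<zero>\<^bsub>M\<^esub>}"
  | "list_smult M H (g # gs) =
      {g \<odot>\<^bsub>M\<^esub> z \<oplus>\<^bsub>M\<^esub> w | z w. z \<in> H \<and> w \<in> list_smult M H gs}"

lemma (in module) partial_sum_closed:
  assumes "\<And>n. y n \<in> carrier M"
  shows "partial_sum M y n \<in> carrier M"
  using assms by (induction n) auto

lemma (in module) partial_sum_hom:
  assumes "h \<in> mod_hom R M N" "module R N" "\<And>n. y n \<in> carrier M"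
  shows "h (partial_sum M y n) = partial_sum N (\<lambda>n. h (y n)) n"
  using assms mod_hom_zero[OF module_axioms assms(2,1)]
  by (induction n) (simp_all add: mod_homD[OF assms(1)] partial_sum_closed)

lemma (in module) partial_sum_add:
  assumes "\<And>n. y n \<in> carrier M" "\<And>n. z n \<in> carrier M"
  shows "partial_sum M (\<lambda>n. y n \<oplus>\<^bsub>M\<^esub> z n) n = partial_sum M y n \<oplus>\<^bsub>M\<^esub> partial_sum M z n"
  using assms by (induction n) (simp_all add: partial_sum_closed M.a_ac)

lemma (in module) partial_sum_smult:
  assumes "\<And>n. y n \<in> carrier M" "a \<in> carrier R"
  shows "partial_sum M (\<lambda>n. a \<odot>\<^bsub>M\<^esub> y n) n = a \<odot>\<^bsub>M\<^esub> partial_sum M y n"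
  using assms by (induction n) (simp_all add: partial_sum_closed smult_r_distr)

lemma (in module) partial_sum_shift:
  assumes "\<And>n. y n \<in> carrier M"
  shows "partial_sum M y (k + n) = partial_sum M y k \<oplus>\<^bsub>M\<^esub> partial_sum M (\<lambda>n. y (k + n)) n"
  using assms by (induction n) (simp_all add: partial_sum_closed M.a_ac)

lemma (in module) submodule_diff:
  assumes "submodule H R M" "x \<in> H" "y \<in> H"
  shows "x \<ominus>\<^bsub>M\<^esub> y \<in> H"
  using submoduleE[OF assms(1)] assms(2,3) by (simp add: a_minus_def)

lemma (in module) submodule_zero:
  assumes "submodule H R M"
  shows "\<zero>\<^bsub>M\<^esub> \<in> H"
  using subgroup.one_closed[OF submodule.axioms(1)[OF assms]] by simp

lemma (in module) list_smult_submodule: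
  assumes "submodule H R M" "set gs \<subseteq> carrier R"
  shows "submodule (list_smult M H gs) R M"
  using assms(2)
proof (induction gs)
  case Nil
  then show ?case
    by (auto intro!: submoduleI)
next
  case (Cons g gs)
  note H = submoduleE[OF assms(1)] and W = submoduleE[OF Cons.IH]
  have g: "g \<in> carrier R" and gs: "set gs \<subseteq> carrier R"
    using Cons.prems by auto
  have Hc: "\<And>z. z \<in> H \<Longrightarrow> z \<in> carrier M" using H(1) by auto
  have Wc: "\<And>w. w \<in> list_smult M H gs \<Longrightarrow> w \<in> carrier M" using W(1)[OF gs] by auto
  show ?case
  proof (rule submoduleI)
    show "list_smult M H (g # gs) \<subseteq> carrier M"
      using g Hc Wc by auto
    have "\<zero>\<^bsub>M\<^esub> = g \<odot>\<^bsub>M\<^esub> \<zero>\<^bsub>M\<^esub> \<oplus>\<^bsub>M\<^esub> \<zero>\<^bsub>M\<^esub>"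
      using g by simp
    then show "\<zero>\<^bsub>M\<^esub> \<in> list_smult M H (g # gs)"
      using submodule_zero[OF assms(1)] submodule_zero[OF Cons.IH[OF gs]] by fastforce
  next
    fix x assume "x \<in> list_smult M H (g # gs)"
    then obtain z w where x: "x = g \<odot>\<^bsub>M\<^esub> z \<oplus>\<^bsub>M\<^esub> w" and z: "z \<in> H" and w: "w \<in> list_smult M H gs"
      by auto
    have "\<ominus>\<^bsub>M\<^esub> x = g \<odot>\<^bsub>M\<^esub> (\<ominus>\<^bsub>M\<^esub> z) \<oplus>\<^bsub>M\<^esub> (\<ominus>\<^bsub>M\<^esub> w)"
      using x g Hc[OF z] Wc[OF w] by (simp add: smult_r_minus M.minus_add)
    then show "\<ominus>\<^bsub>M\<^esub> x \<in> list_smult M H (g # gs)"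
      using H(3)[OF z] W(3)[OF gs w] by auto
    fix y assume "y \<in> list_smult M H (g # gs)"
    then obtain z' w' where y: "y = g \<odot>\<^bsub>M\<^esub> z' \<oplus>\<^bsub>M\<^esub> w'" and z': "z' \<in> H" and w': "w' \<in> list_smult M H gs"
      by auto
    have "x \<oplus>\<^bsub>M\<^esub> y = g \<odot>\<^bsub>M\<^esub> (z \<oplus>\<^bsub>M\<^esub> z') \<oplus>\<^bsub>M\<^esub> (w \<oplus>\<^bsub>M\<^esub> w')"
      using x y g Hc[OF z] Wc[OF w] Hc[OF z'] Wc[OF w'] by (simp add: smult_r_distr M.a_ac)
    then show "x \<oplus>\<^bsub>M\<^esub> y \<in> list_smult M H (g # gs)"
      using H(5)[OF z z'] W(5)[OF gs w w'] by auto
  next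
    fix a x assume a: "a \<in> carrier R" and "x \<in> list_smult M H (g # gs)"
    then obtain z w where x: "x = g \<odot>\<^bsub>M\<^esub> z \<oplus>\<^bsub>M\<^esub> w" and z: "z \<in> H" and w: "w \<in> list_smult M H gs"
      by auto
    have "a \<odot>\<^bsub>M\<^esub> x = g \<odot>\<^bsub>M\<^esub> (a \<odot>\<^bsub>M\<^esub> z) \<oplus>\<^bsub>M\<^esub> a \<odot>\<^bsub>M\<^esub> w"
      using x g a Hc[OF z] Wc[OF w]
      by (simp add: smult_r_distr smult_assoc1[symmetric] R.m_comm)
    then show "a \<odot>\<^bsub>M\<^esub> x \<in> list_smult M H (g # gs)"
      using H(4)[OF a z] W(4)[OF gs a w] by auto
  qed
qed

lemma (in module) smult_in_list_smult:
  assumes "submodule H R M" "set gs \<subseteq> carrier R" "g \<in> set gs" "z \<in> H"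
  shows "g \<odot>\<^bsub>M\<^esub> z \<in> list_smult M H gs"
  using assms(2,3)
proof (induction gs)
  case (Cons g' gs)
  have zc: "z \<in> carrier M"
    using submoduleE(1)[OF assms(1)] assms(4) by auto
  have sub: "submodule (list_smult M H gs) R M"
    using Cons.prems by (intro list_smult_submodule assms(1)) auto
  consider "g = g'" | "g \<in> set gs"
    using Cons.prems by auto
  then show ?case
  proof cases
    case 1
    have "g \<odot>\<^bsub>M\<^esub> z = g' \<odot>\<^bsub>M\<^esub> z \<oplus>\<^bsub>M\<^esub> \<zero>\<^bsub>M\<^esub>"
      using 1 Cons.prems zc by simp
    then show ?thesis
      using submodule_zero[OF sub] assms(4) by auto
  next
    case 2
    have "g \<odot>\<^bsub>M\<^esub> z \<in> list_smult M H gs"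
      using 2 Cons by auto
    moreover from this have "g \<odot>\<^bsub>M\<^esub> z = g' \<odot>\<^bsub>M\<^esub> \<zero>\<^bsub>M\<^esub> \<oplus>\<^bsub>M\<^esub> g \<odot>\<^bsub>M\<^esub> z"
      using Cons.prems submoduleE(1)[OF sub] by auto
    ultimately show ?thesis
      using submodule_zero[OF assms(1)] by auto
  qed
qed simp

text \<open>The scalars that carry all of \<open>H\<close> into \<open>list_smult M H gs\<close>
  form an ideal, and this ideal contains the generators. Explicit linear combinations of the
  generators are thereby avoided.\<close>

lemma (in module) genideal_smult_in_list_smult:
  assumes "submodule H R M" "set gs \<subseteq> carrier R" "a \<in> Idl\<^bsub>R\<^esub> (set gs)" "z \<in> H"
  shows "a \<odot>\<^bsub>M\<^esub> z \<in> list_smult M H gs"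
proof -
  let ?W = "list_smult M H gs"
  let ?J = "{a \<in> carrier R. \<forall>z\<in>H. a \<odot>\<^bsub>M\<^esub> z \<in> ?W}"
  have sub: "submodule ?W R M"
    by (intro list_smult_submodule assms)
  note W = submoduleE[OF sub] and H = submoduleE[OF assms(1)]
  have Hc: "\<And>z. z \<in> H \<Longrightarrow> z \<in> carrier M" using H(1) by auto
  have "ideal ?J R"
  proof (rule idealI)
    show "ring R" by (rule R.ring_axioms)
    show "subgroup ?J (add_monoid R)"
    proof
      fix x assume "x \<in> ?J"
      then have "\<ominus>\<^bsub>R\<^esub> x \<in> ?J"
        using W(3) Hc by (auto simp: smult_l_minus)
      then show "inv\<^bsub>add_monoid R\<^esub> x \<in> ?J"
        by (simp add: a_inv_def)
    qed (use W(5) Hc submodule_zero[OF sub] in \<open>auto simp: smult_l_distr\<close>)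
    fix a x assume "a \<in> ?J" and x: "x \<in> carrier R"
    then show "x \<otimes>\<^bsub>R\<^esub> a \<in> ?J"
      using W(4) Hc by (auto simp: smult_assoc1)
    then show "a \<otimes>\<^bsub>R\<^esub> x \<in> ?J"
      using \<open>a \<in> ?J\<close> x by (simp add: R.m_comm)
  qed
  moreover have "set gs \<subseteq> ?J"
    using smult_in_list_smult[OF assms(1,2)] assms(2) by auto
  ultimately have "Idl\<^bsub>R\<^esub> (set gs) \<subseteq> ?J"
    by (rule R.genideal_minimal)
  then show ?thesis
    using assms(3,4) by auto
qed

section \<open>Powers of an ideal and the submodules they generate\<close>

lemma (in cring) ideals_set_pow_ideal:
  assumes "ideal \<aa> R"
  shows "ideal (\<aa> [^]\<^bsub>ideals_set R\<^esub> (n::nat)) R"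
proof -
  interpret S: semiring "ideals_set R" by (rule ideals_set_is_semiring)
  have "\<aa> [^]\<^bsub>ideals_set R\<^esub> n \<in> carrier (ideals_set R)"
    using assms by (intro S.nat_pow_closed) (simp add: ideals_set_def)
  then show ?thesis
    by (simp add: ideals_set_def)
qed

lemma (in module) ideal_smult_submodule:
  assumes "ideal \<bb> R"
  shows "submodule (ideal_smult M \<bb>) R M"
proof -
  interpret b: ideal \<bb> R by fact
  have c: "x \<in> carrier M" if "x \<in> ideal_smult M \<bb>" for x
    using that by induction auto
  show ?thesis
  proof (rule submoduleI)
    show "ideal_smult M \<bb> \<subseteq> carrier M"
      using c by auto
    show "\<zero>\<^bsub>M\<^esub> \<in> ideal_smult M \<bb>"
      using ideal_smult.smult[of "\<zero>\<^bsub>R\<^esub>" \<bb> "\<zero>\<^bsub>M\<^esub>" M] by simp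
    show sm: "a \<odot>\<^bsub>M\<^esub> x \<in> ideal_smult M \<bb>" if "a \<in> carrier R" "x \<in> ideal_smult M \<bb>" for a x
      using that(2)
    proof induction
      case (smult b x)
      then show ?case
        using that(1) b.I_l_closed[OF smult(1)]
        by (auto simp: smult_assoc1[symmetric] intro!: ideal_smult.smult)
    next
      case (sum x y)
      then show ?case
        using that(1) by (auto simp: smult_r_distr c intro!: ideal_smult.sum)
    qed
    \<comment> \<open>The inductive set has no rule for negatives; they arise as multiples by
      -1.\<close>
    show "\<ominus>\<^bsub>M\<^esub> x \<in> ideal_smult M \<bb>" if "x \<in> ideal_smult M \<bb>" for x
      using sm[OF _ that, of "\<ominus>\<^bsub>R\<^esub> \<one>\<^bsub>R\<^esub>"] c[OF that] by (simp add: smult_l_minus)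
  qed (rule ideal_smult.sum)
qed

lemma (in module) minus_zero: "\<ominus>\<^bsub>M\<^esub> \<zero>\<^bsub>M\<^esub> = \<zero>\<^bsub>M\<^esub>"
  by (rule M.minus_equality) simp_all

lemma (in module) diff_eq_zeroD:
  assumes "x \<in> carrier M" "y \<in> carrier M" "x \<ominus>\<^bsub>M\<^esub> y = \<zero>\<^bsub>M\<^esub>"
  shows "x = y"
proof -
  have "x = (x \<ominus>\<^bsub>M\<^esub> y) \<oplus>\<^bsub>M\<^esub> y"
    using assms(1,2) by (simp add: a_minus_def M.a_assoc M.l_neg)
  then show ?thesis
    using assms by simp
qed

section \<open>Adic completeness via series\<close>

locale adic_module = module R M for R and M (structure) +
  fixes \<aa>
  assumes ideal: "ideal \<aa> R"
begin

abbreviation filt where "filt n \<equiv> adic_submodule R \<aa> M n"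

lemma filt_submodule: "submodule (filt n) R M"
  unfolding adic_submodule_def
  by (intro ideal_smult_submodule R.ideals_set_pow_ideal ideal)

lemmas filt_subset = submoduleE(1)[OF filt_submodule]
  and filt_smult = submoduleE(4)[OF filt_submodule]
  and filt_add = submoduleE(5)[OF filt_submodule]
  and filt_zero = submodule_zero[OF filt_submodule]
  and filt_diff = submodule_diff[OF filt_submodule]

lemma filt_closed: "x \<in> filt n \<Longrightarrow> x \<in> carrier M"
  using filt_subset by auto

lemma filt_0: "filt 0 = carrier M"
proof
  show "carrier M \<subseteq> filt 0"
  proof
    fix x assume "x \<in> carrier M"
    then show "x \<in> filt 0"
      using ideal_smult.smult[of "\<one>\<^bsub>R\<^esub>" "carrier R" x M]
      by (simp add: adic_submodule_def ideals_set_def)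
  qed
qed (rule filt_subset)

lemma pow_Suc:
  "\<aa> [^]\<^bsub>ideals_set R\<^esub> Suc n = ideal_prod R (\<aa> [^]\<^bsub>ideals_set R\<^esub> n) \<aa>"
proof -
  interpret S: semiring "ideals_set R" by (rule R.ideals_set_is_semiring)
  show ?thesis
    by (simp add: ideals_set_def)
qed

lemma filt_Suc_subset: "filt (Suc n) \<subseteq> filt n"
proof
  fix x assume "x \<in> filt (Suc n)"
  then have "x \<in> ideal_smult M (ideal_prod R (\<aa> [^]\<^bsub>ideals_set R\<^esub> n) \<aa>)"
    by (simp only: adic_submodule_def pow_Suc)
  then show "x \<in> filt n"
    unfolding adic_submodule_def
  proof induction
    case (smult a x)
    then show ?case
      using R.ideal_prod_inter[OF R.ideals_set_pow_ideal[OF ideal] ideal]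
      by (intro ideal_smult.smult) auto
  qed (rule ideal_smult.sum)
qed

lemma filt_antimono: "m \<le> n \<Longrightarrow> filt n \<subseteq> filt m"
  using lift_Suc_antimono_le[of "\<lambda>n. filt n"] filt_Suc_subset by blast

text \<open>In a generator b x of \<aa>^n M the coefficient b absorbs a, and b a lies in \<aa>^n
  \<aa>. The gain of one power is what later puts g_l t_l into \<aa>^(k+1) L.\<close>

lemma smult_filt_Suc:
  assumes "a \<in> \<aa>" "x \<in> filt n"
  shows "a \<odot> x \<in> filt (Suc n)"
proof -
  interpret a: ideal \<aa> R by (rule ideal)
  interpret b: ideal "\<aa> [^]\<^bsub>ideals_set R\<^esub> n" R by (rule R.ideals_set_pow_ideal[OF ideal])
  have "x \<in> ideal_smult M (\<aa> [^]\<^bsub>ideals_set R\<^esub> n)"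
    using assms(2) by (simp add: adic_submodule_def)
  then have "x \<in> carrier M \<and>
      a \<odot> x \<in> ideal_smult M (ideal_prod R (\<aa> [^]\<^bsub>ideals_set R\<^esub> n) \<aa>)"
  proof induction
    case (smult b x)
    then have "a \<odot> (b \<odot> x) = (b \<otimes>\<^bsub>R\<^esub> a) \<odot> x"
      using assms(1) by (simp add: smult_assoc1[symmetric] R.m_comm)
    then show ?case
      using smult assms(1) by (auto intro!: ideal_smult.smult ideal_prod.prod)
  next
    case (sum x y)
    then show ?case
      using assms(1) by (auto simp: smult_r_distr intro!: ideal_smult.sum)
  qed
  then show ?thesis
    by (simp only: adic_submodule_def pow_Suc)
qed

text \<open>This is where generators of \<aa> enter: the same finite list serves for every element
  and every n. A product (b a) x with b in \<aa>^n and a in \<aa> is reordered as a (b x), so that a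
  acts on an element of \<aa>^n M.\<close>

lemma filt_Suc_subset_list_smult:
  assumes "\<aa> = Idl\<^bsub>R\<^esub> (set gs)" "set gs \<subseteq> carrier R"
  shows "filt (Suc n) \<subseteq> list_smult M (filt n) gs"
proof
  interpret a: ideal \<aa> R by (rule ideal)
  interpret b: ideal "\<aa> [^]\<^bsub>ideals_set R\<^esub> n" R by (rule R.ideals_set_pow_ideal[OF ideal])
  let ?W = "list_smult M (filt n) gs"
  have sub: "submodule ?W R M"
    by (intro list_smult_submodule filt_submodule assms)
  have prod: "c \<odot> x \<in> ?W"
    if "c \<in> ideal_prod R (\<aa> [^]\<^bsub>ideals_set R\<^esub> n) \<aa>" "x \<in> carrier M" for c x
  proof -
    from that(1) have "c \<in> carrier R \<and> c \<odot> x \<in> ?W"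
    proof induction
      case (prod b a)
      have "b \<odot> x \<in> filt n"
        unfolding adic_submodule_def using prod(1) that(2) by (rule ideal_smult.smult)
      then have "a \<odot> (b \<odot> x) \<in> ?W"
        using prod(2) assms by (intro genideal_smult_in_list_smult filt_submodule) auto
      then show ?case
        using prod that(2) by (simp add: smult_assoc1[symmetric] R.m_comm)
    next
      case (sum s t)
      then show ?case
        using that(2) submoduleE(5)[OF sub] by (simp add: smult_l_distr)
    qed
    then show ?thesis ..
  qed
  fix x assume "x \<in> filt (Suc n)"
  then have "x \<in> ideal_smult M (ideal_prod R (\<aa> [^]\<^bsub>ideals_set R\<^esub> n) \<aa>)"
    by (simp only: adic_submodule_def pow_Suc)
  then show "x \<in> ?W"
    by induction (auto intro: prod submoduleE(5)[OF sub])
qed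

lemma list_smult_subset_filt:
  assumes "set gs \<subseteq> carrier R"
  shows "list_smult M (filt n) gs \<subseteq> filt n"
  using assms by (induction gs) (auto intro!: filt_zero filt_add filt_smult)

section \<open>Cosets of \<aa>^n M and the canonical map to the completion\<close>

lemma filt_abelian_subgroup: "abelian_subgroup (filt n) M"
  by (intro abelian_subgroupI3 additive_subgroupI M.abelian_group_axioms)
     (rule submodule.axioms(1)[OF filt_submodule])

lemma coset_eq_iff:
  assumes "x \<in> carrier M" "y \<in> carrier M"
  shows "filt n +> x = filt n +> y \<longleftrightarrow> x \<ominus> y \<in> filt n"
proof -
  interpret H: abelian_subgroup "filt n" M by (rule filt_abelian_subgroup)
  show ?thesis
    using assms H.a_rcos_module[OF assms(2,1)] H.a_repr_independence'[of x y]
      H.a_rcos_self[of x]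
    by (auto simp: a_minus_def)
qed

text \<open>Evaluates the projection \<open>adic_proj\<close> on a coset: \<aa>^m M absorbs the
  smaller submodule \<aa>^n M.\<close>

lemma filt_add_coset:
  assumes "m \<le> n" "x \<in> carrier M"
  shows "filt m <+> (filt n +> x) = filt m +> x"
proof -
  have "filt m <+> filt n = filt m"
  proof
    show "filt m <+> filt n \<subseteq> filt m"
      using filt_antimono[OF assms(1)] by (auto simp: set_add_def' intro!: filt_add)
    show "filt m \<subseteq> filt m <+> filt n"
      using filt_zero[of n] filt_closed by (fastforce simp: set_add_def' intro: M.r_zero[symmetric])
  qed
  then show ?thesis
    using M.a_setmult_rcos_assoc[OF filt_subset filt_subset assms(2), of m n] by simp
qed

lemma adic_completion_carrier:
  "X \<in> carrier (adic_completion R \<aa> M) \<longleftrightarrow>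
    (\<forall>n. X n \<in> a_rcosets (filt n)) \<and> (\<forall>m n. m \<le> n \<longrightarrow> filt m <+> X n = X m)"
  by (auto simp: adic_completion_def inverse_limit_def adic_quot_def quot_module_def adic_proj_def)

lemma adic_canonical_hom: "adic_canonical R \<aa> M \<in> mod_hom R M (adic_completion R \<aa> M)"
proof (rule mod_homI)
  fix x assume "x \<in> carrier M"
  then show "adic_canonical R \<aa> M x \<in> carrier (adic_completion R \<aa> M)"
    by (auto simp: adic_completion_carrier adic_canonical_def filt_add_coset
        intro: M.a_rcosetsI[OF filt_subset])
next
  fix x y assume "x \<in> carrier M" "y \<in> carrier M"
  then show "adic_canonical R \<aa> M (x \<oplus> y) =
      adic_canonical R \<aa> M x \<oplus>\<^bsub>adic_completion R \<aa> M\<^esub> adic_canonical R \<aa> M y"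
    using abelian_subgroup.a_rcos_sum[OF filt_abelian_subgroup]
    by (simp add: adic_completion_def inverse_limit_def adic_quot_def quot_module_def
        adic_canonical_def fun_eq_iff)
next
  fix a x assume a: "a \<in> carrier R" and x: "x \<in> carrier M"
  \<comment> \<open>Scalar multiplication in the quotient is a union over all representatives z of
    the coset. The united cosets all agree because a (z - x) lies in \<aa>^n M, and the union is
    nonempty because x is itself a representative.\<close>
  have "(\<Union>z\<in>filt n +> x. filt n +> (a \<odot> z)) = filt n +> (a \<odot> x)" for n
  proof -
    interpret H: abelian_subgroup "filt n" M by (rule filt_abelian_subgroup)
    have "filt n +> (a \<odot> z) = filt n +> (a \<odot> x)" if z: "z \<in> filt n +> x" for z
    proof -
      have zc: "z \<in> carrier M"
        using z x H.a_elemrcos_carrier by blast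
      then have "z \<ominus> x \<in> filt n"
        using H.a_rcos_module[OF x zc] z by (simp add: a_minus_def)
      then have "a \<odot> (z \<ominus> x) \<in> filt n"
        using a by (intro filt_smult)
      then show ?thesis
        using a x zc by (simp add: coset_eq_iff a_minus_def smult_r_distr smult_r_minus)
    qed
    moreover have "x \<in> filt n +> x"
      using H.a_rcos_self[OF x] .
    ultimately show ?thesis by blast
  qed
  then show "adic_canonical R \<aa> M (a \<odot> x) =
      a \<odot>\<^bsub>adic_completion R \<aa> M\<^esub> adic_canonical R \<aa> M x"
    by (simp add: adic_completion_def inverse_limit_def adic_quot_def quot_module_def
        adic_canonical_def fun_eq_iff)
qed

section \<open>Completeness as separatedness plus convergence of series\<close>

text \<open>The terms \<open>y m\<close>, ..., \<open>y (n - 1)\<close> that make up the difference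
  all lie in \<aa>^m M. The partial sums thus form a Cauchy sequence.\<close>

lemma partial_sum_diff_in_filt:
  assumes "\<And>n. y n \<in> filt n" "m \<le> n"
  shows "partial_sum M y n \<ominus> partial_sum M y m \<in> filt m"
  using assms(2)
proof (induction n rule: dec_induct)
  case base
  have "partial_sum M y m \<in> carrier M"
    using assms(1) filt_closed by (intro partial_sum_closed) blast
  then show ?case
    using filt_zero by (simp add: a_minus_def M.r_neg)
next
  case (step n)
  have c: "partial_sum M y k \<in> carrier M" "y k \<in> carrier M" for k
    using assms(1) filt_closed by (blast intro: partial_sum_closed)+
  have "y n \<in> filt m"
    using assms(1) filt_antimono step.hyps by auto
  then have "(partial_sum M y n \<ominus> partial_sum M y m) \<oplus> y n \<in> filt m"
    using step.IH by (intro filt_add)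
  then show ?case
    by (simp add: a_minus_def c M.a_ac)
qed

text \<open>Uses injectivity of the canonical map: such an x has the same image as 0.\<close>

lemma completeD_separated:
  assumes "adically_complete R \<aa> M" "x \<in> carrier M" "\<And>n. x \<in> filt n"
  shows "x = \<zero>"
proof -
  have "adic_canonical R \<aa> M x = adic_canonical R \<aa> M \<zero>"
    using assms(2,3) by (simp add: adic_canonical_def fun_eq_iff coset_eq_iff a_minus_def minus_zero)
  then show ?thesis
    using assms(1,2) by (auto simp: adically_complete_def mod_iso_def bij_betw_def inj_on_def)
qed

text \<open>Uses surjectivity of the canonical map: the cosets of the partial sums form a compatible
  family by the Cauchy property, and a preimage of this family is a sum of the series.\<close>

lemma completeD_sums:
  assumes "adically_complete R \<aa> M" "\<And>n. y n \<in> filt n"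
  shows "\<exists>s. adic_sums R \<aa> M y s"
proof -
  let ?X = "\<lambda>n. filt n +> partial_sum M y n"
  have c: "partial_sum M y k \<in> carrier M" for k
    using assms(2) filt_closed by (blast intro: partial_sum_closed)
  have "?X \<in> carrier (adic_completion R \<aa> M)"
    using c partial_sum_diff_in_filt[OF assms(2)]
    by (auto simp: adic_completion_carrier filt_add_coset coset_eq_iff
        intro: M.a_rcosetsI[OF filt_subset])
  then have "?X \<in> adic_canonical R \<aa> M ` carrier M"
    using assms(1) by (simp add: adically_complete_def mod_iso_def bij_betw_def)
  then obtain s where "s \<in> carrier M" "?X = adic_canonical R \<aa> M s"
    by (rule imageE)
  then show ?thesis
    using c by (auto simp: adic_sums_def adic_canonical_def fun_eq_iff coset_eq_iff[symmetric])
qed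

text \<open>Separatedness gives injectivity of the canonical map. For surjectivity, a compatible
  family of cosets is turned into a telescoping series.\<close>

lemma completeI:
  assumes separated: "\<And>x. \<lbrakk>x \<in> carrier M; \<And>n. x \<in> filt n\<rbrakk> \<Longrightarrow> x = \<zero>"
    and sums: "\<And>y. (\<And>n. y n \<in> filt n) \<Longrightarrow> \<exists>s. adic_sums R \<aa> M y s"
  shows "adically_complete R \<aa> M"
proof -
  let ?c = "adic_canonical R \<aa> M"
  have "inj_on ?c (carrier M)"
  proof (rule inj_onI)
    fix x y assume xy: "x \<in> carrier M" "y \<in> carrier M" and "?c x = ?c y"
    then have "x \<ominus> y \<in> filt n" for n
      by (auto simp: adic_canonical_def fun_eq_iff coset_eq_iff)
    then have "x \<ominus> y = \<zero>"
      using xy by (intro separated) auto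
    then show "x = y"
      using xy by (simp add: diff_eq_zeroD)
  qed
  moreover have "X \<in> ?c ` carrier M" if X: "X \<in> carrier (adic_completion R \<aa> M)" for X
  proof -
    have "\<forall>n. \<exists>x. x \<in> carrier M \<and> X n = filt n +> x"
      using X by (simp add: adic_completion_carrier A_RCOSETS_def') blast
    from choice[OF this] obtain x where x: "\<And>n. x n \<in> carrier M" "\<And>n. X n = filt n +> x n"
      by blast
    \<comment> \<open>Successive differences of chosen representatives. Compatibility of
      \<open>X\<close> makes \<open>x (Suc n)\<close> and \<open>x n\<close> congruent modulo
      \<aa>^n M, so that \<open>y n\<close> lies there.\<close>
    define y where "y n = x (Suc n) \<ominus> x n" for n
    have yc: "y n \<in> carrier M" for n
      by (simp add: y_def x)
    have "filt n +> x (Suc n) = filt n +> x n" for n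
    proof -
      have "filt n <+> X (Suc n) = X n"
        using X by (simp add: adic_completion_carrier)
      then show ?thesis
        by (simp add: x filt_add_coset)
    qed
    then have "y n \<in> filt n" for n
      by (simp add: y_def x coset_eq_iff[symmetric])
    then obtain s where s: "adic_sums R \<aa> M y s"
      using sums by blast
    have P: "partial_sum M y n \<in> carrier M" for n
      using yc by (rule partial_sum_closed)
    \<comment> \<open>The series telescopes to \<open>x n\<close> minus the starting value
      \<open>x 0\<close>; hence the preimage of \<open>X\<close> is \<open>x 0 \<oplus> s\<close>
      and not \<open>s\<close>.\<close>
    have xP: "x 0 \<oplus> partial_sum M y n = x n" for n
    proof (induction n)
      case (Suc n)
      have "x 0 \<oplus> partial_sum M y (Suc n) = (x 0 \<oplus> partial_sum M y n) \<oplus> y n"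
        using P yc x(1) by (simp add: M.a_assoc)
      also have "\<dots> = x n \<oplus> (x (Suc n) \<oplus> \<ominus> x n)"
        by (simp only: Suc y_def a_minus_def)
      also have "\<dots> = x (Suc n)"
        using x(1)[of n] x(1)[of "Suc n"] by (simp add: M.a_lcomm[of "x n" "x (Suc n)"] M.r_neg)
      finally show ?case .
    qed (simp add: x(1))
    have sc: "s \<in> carrier M"
      using s by (simp add: adic_sums_def)
    have "(x 0 \<oplus> s) \<ominus> x n \<in> filt n" for n
    proof -
      have "(x 0 \<oplus> s) \<ominus> (x 0 \<oplus> partial_sum M y n) = s \<ominus> partial_sum M y n"
        using sc x(1)[of 0] P[of n]
        by (simp add: a_minus_def M.minus_add M.a_ac M.r_neg1 M.r_neg2)
      then show ?thesis
        using s by (simp only: xP adic_sums_def)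
    qed
    then have "?c (x 0 \<oplus> s) = X"
      using sc x by (simp add: fun_eq_iff adic_canonical_def coset_eq_iff)
    then show ?thesis
      using sc x(1) by blast
  qed
  ultimately show ?thesis
    using adic_canonical_hom mod_homD(1)[OF adic_canonical_hom] module_axioms
    by (auto simp: adically_complete_def mod_iso_def bij_betw_def)
qed

section \<open>Calculation rules for adic sums\<close>

lemma adic_sums_closed: "adic_sums R \<aa> M y s \<Longrightarrow> s \<in> carrier M"
  by (simp add: adic_sums_def)

text \<open>With P_n the n-th partial sum, s - t = (s - P_n) - (t - P_n) lies in \<aa>^n M for every
  n, and separatedness applies.\<close>

lemma adic_sums_unique:
  assumes "adically_complete R \<aa> M" "\<And>n. y n \<in> carrier M"
    and s: "adic_sums R \<aa> M y s" and t: "adic_sums R \<aa> M y t"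
  shows "s = t"
proof -
  have c: "partial_sum M y n \<in> carrier M" for n
    using assms(2) by (rule partial_sum_closed)
  have st: "s \<in> carrier M" "t \<in> carrier M"
    using s t by (auto intro: adic_sums_closed)
  have "s \<ominus> t \<in> filt n" for n
  proof -
    have "(s \<ominus> partial_sum M y n) \<ominus> (t \<ominus> partial_sum M y n) \<in> filt n"
      using s t by (auto simp: adic_sums_def intro: filt_diff)
    moreover have "(s \<ominus> partial_sum M y n) \<ominus> (t \<ominus> partial_sum M y n) = s \<ominus> t"
      using c[of n] st by (simp add: a_minus_def M.minus_add M.a_ac M.r_neg M.r_neg1 M.r_neg2)
    ultimately show ?thesis by simp
  qed
  then have "s \<ominus> t = \<zero>"
    using st by (intro completeD_separated assms) auto
  then show ?thesis
    using st by (simp add: diff_eq_zeroD)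
qed

lemma adic_sums_add:
  assumes "\<And>n. y n \<in> carrier M" "\<And>n. z n \<in> carrier M"
    and "adic_sums R \<aa> M y s" "adic_sums R \<aa> M z t"
  shows "adic_sums R \<aa> M (\<lambda>n. y n \<oplus> z n) (s \<oplus> t)"
proof -
  have "(s \<ominus> partial_sum M y n) \<oplus> (t \<ominus> partial_sum M z n) \<in> filt n" for n
    using assms(3,4) by (intro filt_add) (auto simp: adic_sums_def)
  then show ?thesis
    using assms partial_sum_closed[OF assms(1)] partial_sum_closed[OF assms(2)]
    by (simp add: adic_sums_def partial_sum_add a_minus_def M.minus_add M.a_ac)
qed

lemma adic_sums_smult:
  assumes "\<And>n. y n \<in> carrier M" "a \<in> carrier R" "adic_sums R \<aa> M y s"
  shows "adic_sums R \<aa> M (\<lambda>n. a \<odot> y n) (a \<odot> s)"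
proof -
  have "a \<odot> (s \<ominus> partial_sum M y n) \<in> filt n" for n
    using assms(2,3) by (intro filt_smult) (auto simp: adic_sums_def)
  then show ?thesis
    using assms partial_sum_closed[OF assms(1)]
    by (simp add: adic_sums_def partial_sum_smult a_minus_def smult_r_distr smult_r_minus)
qed

lemma adic_sums_zero: "adic_sums R \<aa> M (\<lambda>n. \<zero>) \<zero>"
proof -
  have "partial_sum M (\<lambda>n. \<zero>) n = \<zero>" for n
    by (induction n) auto
  then show ?thesis
    by (simp add: adic_sums_def a_minus_def minus_zero filt_zero)
qed

text \<open>The n-th remainder of the shifted series is remainder number k + n of the original one.
  It lies in \<aa>^(k+n) M, hence in \<aa>^n M.\<close>

lemma adic_sums_shift:
  assumes "\<And>n. y n \<in> carrier M" "adic_sums R \<aa> M y s"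
  shows "adic_sums R \<aa> M (\<lambda>n. y (k + n)) (s \<ominus> partial_sum M y k)"
proof -
  have c: "partial_sum M y n \<in> carrier M" "partial_sum M (\<lambda>n. y (k + n)) n \<in> carrier M" for n
    using assms(1) by (auto intro: partial_sum_closed)
  have "s \<ominus> partial_sum M y (k + n) \<in> filt n" for n
    using assms(2) filt_antimono[of n "k + n"] by (auto simp: adic_sums_def)
  then show ?thesis
    using assms(2) c
    by (simp add: adic_sums_def partial_sum_shift[OF assms(1)] a_minus_def M.minus_add M.a_ac)
qed

lemma filt_hom:
  assumes "h \<in> mod_hom R M N" "x \<in> filt n"
  shows "h x \<in> adic_submodule R \<aa> N n"
proof -
  interpret b: ideal "\<aa> [^]\<^bsub>ideals_set R\<^esub> n" R by (rule R.ideals_set_pow_ideal[OF ideal])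
  show ?thesis
    using assms b.a_subset module_axioms
    unfolding adic_submodule_def by (blast intro: ideal_smult_image)
qed

text \<open>A linear map sends \<aa>^n M into \<aa>^n N and so maps remainders to remainders. This
  is applied to the transition maps.\<close>

lemma adic_sums_hom:
  assumes "h \<in> mod_hom R M N" "module R N" "\<And>n. y n \<in> carrier M" "adic_sums R \<aa> M y s"
  shows "adic_sums R \<aa> N (\<lambda>n. h (y n)) (h s)"
  using assms filt_hom[OF assms(1)] partial_sum_closed[OF assms(3)]
  by (simp add: adic_sums_def mod_homD(1)[OF assms(1)] partial_sum_hom[OF assms(1-3), symmetric]
      mod_hom_diff[OF module_axioms assms(2,1), symmetric])

end

section \<open>Inverse limits\<close>

lemma inverse_limit_carrier:
  "x \<in> carrier (inverse_limit I r M f) \<longleftrightarrow>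
    x \<in> extensional I \<and> (\<forall>i\<in>I. x i \<in> carrier (M i)) \<and>
    (\<forall>i\<in>I. \<forall>j\<in>I. (i, j) \<in> r \<longrightarrow> f i j (x j) = x i)"
  by (auto simp: inverse_limit_def PiE_def Pi_iff)

lemma inverse_limit_ops:
  "\<zero>\<^bsub>inverse_limit I r M f\<^esub> = (\<lambda>i\<in>I. \<zero>\<^bsub>M i\<^esub>)"
  "x \<oplus>\<^bsub>inverse_limit I r M f\<^esub> y = (\<lambda>i\<in>I. x i \<oplus>\<^bsub>M i\<^esub> y i)"
  "a \<odot>\<^bsub>inverse_limit I r M f\<^esub> x = (\<lambda>i\<in>I. a \<odot>\<^bsub>M i\<^esub> x i)"
  by (simp_all add: inverse_limit_def)

context inverse_system
begin

lemma inverse_limit_module: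
  assumes "cring R"
  shows "module R (inverse_limit I r M f)"
proof (rule moduleI)
  show "cring R" by fact
  let ?L = "inverse_limit I r M f"
  note ops = inverse_limit_ops inverse_limit_carrier
  \<comment> \<open>Members of the limit are extensional functions, hence determined by their values
    on \<open>I\<close>.\<close>
  have eqI: "x = y" if "x \<in> extensional I" "y \<in> extensional I" "\<And>i. i \<in> I \<Longrightarrow> x i = y i" for x y :: "'i \<Rightarrow> 'm"
    using that by (rule extensionalityI)
  have hom: "f i j (x \<oplus>\<^bsub>M j\<^esub> y) = f i j x \<oplus>\<^bsub>M i\<^esub> f i j y"
    "a \<in> carrier R \<Longrightarrow> f i j (a \<odot>\<^bsub>M j\<^esub> x) = a \<odot>\<^bsub>M i\<^esub> f i j x"
    if "i \<in> I" "j \<in> I" "(i, j) \<in> r" "x \<in> carrier (M j)" "y \<in> carrier (M j)" for i j x y a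
    using mod_homD(2,3)[OF transition_hom[OF that(1-3)]] that by auto
  have hom_zero: "f i j \<zero>\<^bsub>M j\<^esub> = \<zero>\<^bsub>M i\<^esub>"
    if "i \<in> I" "j \<in> I" "(i, j) \<in> r" for i j
    using modules transition_hom that by (blast intro: mod_hom_zero)
  have hom_minus: "f i j (\<ominus>\<^bsub>M j\<^esub> x) = \<ominus>\<^bsub>M i\<^esub> f i j x"
    if "i \<in> I" "j \<in> I" "(i, j) \<in> r" "x \<in> carrier (M j)" for i j x
    using modules transition_hom that by (blast intro: mod_hom_minus)
  have ab: "abelian_group (M i)" if "i \<in> I" for i
    using modules[OF that] by (simp add: module_def)
  note am = abelian_group.axioms(1)[OF ab]
  show "abelian_group ?L"
  proof (rule abelian_groupI)
    show "\<zero>\<^bsub>?L\<^esub> \<in> carrier ?L"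
      using abelian_monoid.zero_closed[OF am] hom_zero by (auto simp: ops)
    fix x assume x: "x \<in> carrier ?L"
    show "\<zero>\<^bsub>?L\<^esub> \<oplus>\<^bsub>?L\<^esub> x = x"
      using x by (intro eqI) (auto simp: ops abelian_monoid.l_zero[OF am])
    have "(\<lambda>i\<in>I. \<ominus>\<^bsub>M i\<^esub> x i) \<in> carrier ?L"
      using x abelian_group.a_inv_closed[OF ab] hom_minus by (auto simp: ops)
    moreover have "(\<lambda>i\<in>I. \<ominus>\<^bsub>M i\<^esub> x i) \<oplus>\<^bsub>?L\<^esub> x = \<zero>\<^bsub>?L\<^esub>"
      using x by (intro eqI) (auto simp: ops abelian_group.l_neg[OF ab])
    ultimately show "\<exists>y\<in>carrier ?L. y \<oplus>\<^bsub>?L\<^esub> x = \<zero>\<^bsub>?L\<^esub>" by blast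
    fix y assume y: "y \<in> carrier ?L"
    show "x \<oplus>\<^bsub>?L\<^esub> y \<in> carrier ?L"
      using x y abelian_monoid.a_closed[OF am] hom(1) by (auto simp: ops)
    show "x \<oplus>\<^bsub>?L\<^esub> y = y \<oplus>\<^bsub>?L\<^esub> x"
      using x y by (intro eqI) (auto simp: ops abelian_monoid.a_comm[OF am])
    fix z assume z: "z \<in> carrier ?L"
    show "x \<oplus>\<^bsub>?L\<^esub> y \<oplus>\<^bsub>?L\<^esub> z = x \<oplus>\<^bsub>?L\<^esub> (y \<oplus>\<^bsub>?L\<^esub> z)"
      using x y z by (intro eqI) (auto simp: ops abelian_monoid.a_assoc[OF am])
  qed
  fix a x assume a: "a \<in> carrier R" and x: "x \<in> carrier ?L"
  show "a \<odot>\<^bsub>?L\<^esub> x \<in> carrier ?L"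
    using a x module.smult_closed[OF modules] hom(2) by (auto simp: ops)
  fix b assume b: "b \<in> carrier R"
  show "(a \<oplus>\<^bsub>R\<^esub> b) \<odot>\<^bsub>?L\<^esub> x = a \<odot>\<^bsub>?L\<^esub> x \<oplus>\<^bsub>?L\<^esub> b \<odot>\<^bsub>?L\<^esub> x"
    using a b x by (intro eqI) (auto simp: ops module.smult_l_distr[OF modules])
  show "(a \<otimes>\<^bsub>R\<^esub> b) \<odot>\<^bsub>?L\<^esub> x = a \<odot>\<^bsub>?L\<^esub> (b \<odot>\<^bsub>?L\<^esub> x)"
    using a b x by (intro eqI) (auto simp: ops module.smult_assoc1[OF modules])
next
  let ?L = "inverse_limit I r M f"
  fix x assume "x \<in> carrier ?L"
  then show "\<one>\<^bsub>R\<^esub> \<odot>\<^bsub>?L\<^esub> x = x"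
    by (intro extensionalityI[of _ I])
      (auto simp: inverse_limit_ops inverse_limit_carrier module.smult_one[OF modules])
next
  let ?L = "inverse_limit I r M f"
  fix a x y assume "a \<in> carrier R" "x \<in> carrier ?L" "y \<in> carrier ?L"
  then show "a \<odot>\<^bsub>?L\<^esub> (x \<oplus>\<^bsub>?L\<^esub> y) = a \<odot>\<^bsub>?L\<^esub> x \<oplus>\<^bsub>?L\<^esub> a \<odot>\<^bsub>?L\<^esub> y"
    by (auto simp: inverse_limit_ops inverse_limit_carrier module.smult_r_distr[OF modules])
qed

lemma projection_hom:
  assumes "i \<in> I"
  shows "(\<lambda>x. x i) \<in> mod_hom R (inverse_limit I r M f) (M i)"
  using assms by (auto intro!: mod_homI simp: inverse_limit_ops inverse_limit_carrier)

end

section \<open>Componentwise sums in a limit of complete modules\<close>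

locale complete_system = inverse_system R I r M f
  for R :: "('a, 'r) ring_scheme" and I :: "'i set" and r
    and M :: "'i \<Rightarrow> ('a, 'm, 'x) module_scheme" and f +
  fixes \<aa> :: "'a set"
  assumes cring: "cring R" and ideal: "ideal \<aa> R"
    and complete: "i \<in> I \<Longrightarrow> adically_complete R \<aa> (M i)"
begin

abbreviation L where "L \<equiv> inverse_limit I r M f"

sublocale L: adic_module R L \<aa>
  by (intro adic_module.intro adic_module_axioms.intro inverse_limit_module cring ideal)

lemma component_adic_module: "i \<in> I \<Longrightarrow> adic_module R (M i) \<aa>"
  by (intro adic_module.intro adic_module_axioms.intro modules ideal)

lemma component_closed: "x \<in> carrier L \<Longrightarrow> i \<in> I \<Longrightarrow> x i \<in> carrier (M i)"
  by (simp add: inverse_limit_carrier)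

text \<open>Remainders are tested in each \<aa>^n M_i separately. This is a priori weaker than
  \<open>adic_sums\<close> in \<open>L\<close>, which asks for remainders in \<aa>^n L.\<close>

definition componentwise_sums :: "(nat \<Rightarrow> 'i \<Rightarrow> 'm) \<Rightarrow> ('i \<Rightarrow> 'm) \<Rightarrow> bool"
  where "componentwise_sums y s \<longleftrightarrow>
    s \<in> carrier L \<and> (\<forall>i\<in>I. adic_sums R \<aa> (M i) (\<lambda>n. y n i) (s i))"

text \<open>The projections carry \<aa>^n L into \<aa>^n M_i, so the series converges in every
  complete M_i. Uniqueness of sums makes the resulting family compatible.\<close>

lemma componentwise_sums_exists:
  assumes "\<And>n. y n \<in> L.filt n"
  shows "\<exists>s. componentwise_sums y s"
proof -
  have yc: "y n \<in> carrier L" for n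
    using assms by (rule L.filt_closed)
  have "\<exists>s. adic_sums R \<aa> (M i) (\<lambda>n. y n i) s" if i: "i \<in> I" for i
    using assms L.filt_hom[OF projection_hom[OF i]]
    by (intro adic_module.completeD_sums[OF component_adic_module[OF i] complete[OF i]]) auto
  then obtain t where t: "\<And>i. i \<in> I \<Longrightarrow> adic_sums R \<aa> (M i) (\<lambda>n. y n i) (t i)"
    by metis
  have tc: "t i \<in> carrier (M i)" if "i \<in> I" for i
    using t[OF that] by (simp add: adic_sums_def)
  \<comment> \<open>Both sides are sums in \<open>M i\<close> of the same series, since
    \<open>f i j\<close> preserves sums and the terms \<open>y n\<close> are compatible
    families.\<close>
  have "f i j (t j) = t i" if ij: "i \<in> I" "j \<in> I" "(i, j) \<in> r" for i j
  proof (rule adic_module.adic_sums_unique[OF component_adic_module[OF ij(1)] complete[OF ij(1)]])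
    show "adic_sums R \<aa> (M i) (\<lambda>n. y n i) (t i)"
      using t ij(1) .
    have "adic_sums R \<aa> (M i) (\<lambda>n. f i j (y n j)) (f i j (t j))"
      using ij yc
      by (intro adic_module.adic_sums_hom[OF component_adic_module[OF ij(2)]
            transition_hom[OF ij] modules] component_closed t)
    then show "adic_sums R \<aa> (M i) (\<lambda>n. y n i) (f i j (t j))"
      using yc ij by (simp add: inverse_limit_carrier)
  qed (use ij yc in \<open>auto intro: component_closed\<close>)
  then have "componentwise_sums y (\<lambda>i\<in>I. t i)"
    using t tc by (auto simp: componentwise_sums_def inverse_limit_carrier)
  then show ?thesis by blast
qed

lemma componentwise_sums_unique:
  assumes "\<And>n. y n \<in> carrier L" "componentwise_sums y s" "componentwise_sums y t"
  shows "s = t"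
proof (rule extensionalityI[of _ I])
  fix i assume i: "i \<in> I"
  show "s i = t i"
    using assms i
    by (intro adic_module.adic_sums_unique[OF component_adic_module[OF i] complete[OF i],
          of "\<lambda>n. y n i"])
      (auto simp: componentwise_sums_def intro: component_closed)
qed (use assms in \<open>auto simp: componentwise_sums_def inverse_limit_carrier\<close>)

lemma componentwise_sums_add:
  assumes "\<And>n. y n \<in> carrier L" "\<And>n. z n \<in> carrier L"
    and "componentwise_sums y s" "componentwise_sums z t"
  shows "componentwise_sums (\<lambda>n. y n \<oplus>\<^bsub>L\<^esub> z n) (s \<oplus>\<^bsub>L\<^esub> t)"
  using assms
  by (auto simp: componentwise_sums_def inverse_limit_ops(2)
      intro!: adic_module.adic_sums_add component_adic_module component_closed
        L.M.a_closed[unfolded inverse_limit_ops])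

lemma componentwise_sums_smult:
  assumes "\<And>n. y n \<in> carrier L" "a \<in> carrier R" "componentwise_sums y s"
  shows "componentwise_sums (\<lambda>n. a \<odot>\<^bsub>L\<^esub> y n) (a \<odot>\<^bsub>L\<^esub> s)"
  using assms
  by (auto simp: componentwise_sums_def inverse_limit_ops(3)
      intro!: adic_module.adic_sums_smult component_adic_module component_closed
        L.smult_closed[unfolded inverse_limit_ops])

lemma componentwise_sums_zero: "componentwise_sums (\<lambda>n. \<zero>\<^bsub>L\<^esub>) \<zero>\<^bsub>L\<^esub>"
  using L.M.zero_closed
  by (auto simp: componentwise_sums_def inverse_limit_ops(1)
      intro!: adic_module.adic_sums_zero component_adic_module)

lemma componentwise_sums_shift:
  assumes "\<And>n. y n \<in> carrier L" "componentwise_sums y s"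
  shows "componentwise_sums (\<lambda>n. y (k + n)) (s \<ominus>\<^bsub>L\<^esub> partial_sum L y k)"
proof -
  have s: "s \<in> carrier L"
    using assms(2) by (simp add: componentwise_sums_def)
  have P: "partial_sum L y k \<in> carrier L"
    by (intro L.partial_sum_closed assms)
  have "(s \<ominus>\<^bsub>L\<^esub> partial_sum L y k) i = s i \<ominus>\<^bsub>M i\<^esub> partial_sum (M i) (\<lambda>n. y n i) k" if i: "i \<in> I" for i
    using L.partial_sum_hom[OF projection_hom[OF i] modules[OF i] assms(1)]
      mod_hom_diff[OF L.module_axioms modules[OF i] projection_hom[OF i] s P] by simp
  then show ?thesis
    using s P assms
    by (auto simp: componentwise_sums_def
        intro!: adic_module.adic_sums_shift component_adic_module component_closed)
qed

section \<open>Tails of series and completeness of the limit\<close>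

text \<open>The step from k to k + 1, by induction on the list of generators. The hypothesis
  \<open>filt\<close> is the claim for k; it ranges over all series because it is applied to the
  coefficient series of each generator in turn.\<close>

lemma componentwise_sums_in_filt_list_smult:
  assumes "set gs \<subseteq> \<aa>"
    and filt: "\<And>y s. \<lbrakk>\<And>n. y n \<in> L.filt (k + n); componentwise_sums y s\<rbrakk> \<Longrightarrow> s \<in> L.filt k"
    and "\<And>n. y n \<in> list_smult L (L.filt (k + n)) gs" "componentwise_sums y s"
  shows "s \<in> L.filt (Suc k)"
  using assms(1,3,4)
proof (induction gs arbitrary: y s)
  case Nil
  \<comment> \<open>Without generators all terms vanish, and by uniqueness so does the sum.\<close>
  then have "y = (\<lambda>n. \<zero>\<^bsub>L\<^esub>)"
    by auto
  then have "s = \<zero>\<^bsub>L\<^esub>"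
    using Nil.prems(3) componentwise_sums_zero by (auto intro: componentwise_sums_unique)
  then show ?case
    by (simp add: L.filt_zero)
next
  case (Cons g gs)
  interpret a: ideal \<aa> R by (rule ideal)
  have g: "g \<in> \<aa>" "g \<in> carrier R" and gs: "set gs \<subseteq> \<aa>" "set gs \<subseteq> carrier R"
    using Cons.prems(1) a.a_subset by auto
  have "\<exists>z w. y n = g \<odot>\<^bsub>L\<^esub> z \<oplus>\<^bsub>L\<^esub> w \<and> z \<in> L.filt (k + n) \<and>
      w \<in> list_smult L (L.filt (k + n)) gs" for n
    using Cons.prems(2)[of n] by auto
  then obtain z w where y: "\<And>n. y n = g \<odot>\<^bsub>L\<^esub> z n \<oplus>\<^bsub>L\<^esub> w n"
    and z: "\<And>n. z n \<in> L.filt (k + n)" and w: "\<And>n. w n \<in> list_smult L (L.filt (k + n)) gs"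
    by metis
  \<comment> \<open>Together with the bound for \<open>z\<close>, this ensures that both new series
    have componentwise sums.\<close>
  have w': "w n \<in> L.filt (k + n)" for n
    using w L.list_smult_subset_filt[OF gs(2)] by blast
  have sub: "L.filt (k + n) \<subseteq> L.filt n" for n
    by (rule L.filt_antimono) simp
  obtain t where t: "componentwise_sums z t"
    using componentwise_sums_exists[of z] z sub by blast
  obtain u where u: "componentwise_sums w u"
    using componentwise_sums_exists[of w] w' sub by blast
  have zc: "z n \<in> carrier L" and wc: "w n \<in> carrier L" for n
    using z w' L.filt_closed by blast+
  \<comment> \<open>By linearity the right-hand value is also a componentwise sum of
    \<open>y\<close>, so uniqueness identifies it with \<open>s\<close>.\<close>
  have "componentwise_sums (\<lambda>n. g \<odot>\<^bsub>L\<^esub> z n \<oplus>\<^bsub>L\<^esub> w n) (g \<odot>\<^bsub>L\<^esub> t \<oplus>\<^bsub>L\<^esub> u)"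
    using g zc wc t u by (intro componentwise_sums_add componentwise_sums_smult) auto
  then have "s = g \<odot>\<^bsub>L\<^esub> t \<oplus>\<^bsub>L\<^esub> u"
    using Cons.prems(3) g zc wc unfolding y[abs_def]
    by (intro componentwise_sums_unique[of "\<lambda>n. g \<odot>\<^bsub>L\<^esub> z n \<oplus>\<^bsub>L\<^esub> w n"]) auto
  \<comment> \<open>The claim for k gives t in \<aa>^k L, and the factor g in \<aa> supplies the
    missing power.\<close>
  moreover have "g \<odot>\<^bsub>L\<^esub> t \<in> L.filt (Suc k)"
    using g filt[OF z t] by (intro L.smult_filt_Suc)
  moreover have "u \<in> L.filt (Suc k)"
    using Cons.IH[OF gs(1) w u] .
  ultimately show ?case
    by (simp add: L.filt_add)
qed

text \<open>This upgrades componentwise information to membership in \<aa>^k L. The induction on k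
  must leave the series arbitrary, since it passes from \<open>y\<close> to the coefficient
  series.\<close>

lemma componentwise_sums_in_filt:
  assumes gs: "\<aa> = Idl\<^bsub>R\<^esub> (set gs)" "set gs \<subseteq> carrier R"
    and "\<And>n. y n \<in> L.filt (k + n)" "componentwise_sums y s"
  shows "s \<in> L.filt k"
  using assms(3,4)
proof (induction k arbitrary: y s)
  case 0
  then show ?case
    by (simp add: L.filt_0 componentwise_sums_def)
next
  case (Suc k)
  \<comment> \<open>As \<open>Suc k + n\<close> is \<open>Suc (k + n)\<close>, one factor from \<aa>
    can be split off, leaving coefficients in \<aa>^(k+n) L.\<close>
  have "y n \<in> list_smult L (L.filt (k + n)) gs" for n
    using Suc.prems(1)[of n] L.filt_Suc_subset_list_smult[OF gs, of "k + n"] by auto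
  moreover have "set gs \<subseteq> \<aa>"
    using gs L.R.genideal_self by blast
  ultimately show ?case
    using Suc.prems(2) by (intro componentwise_sums_in_filt_list_smult[OF _ Suc.IH])
qed

theorem inverse_limit_complete:
  assumes "finitely_generated_ideal R \<aa>"
  shows "adically_complete R \<aa> L"
proof (rule L.completeI)
  fix x assume x: "x \<in> carrier L" "\<And>n. x \<in> L.filt n"
  show "x = \<zero>\<^bsub>L\<^esub>"
  proof (rule extensionalityI[of _ I])
    fix i assume i: "i \<in> I"
    have "x i = \<zero>\<^bsub>M i\<^esub>"
      using x i L.filt_hom[OF projection_hom[OF i]]
      by (intro adic_module.completeD_separated[OF component_adic_module[OF i] complete[OF i]])
        (auto intro: component_closed)
    then show "x i = \<zero>\<^bsub>L\<^esub> i"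
      using i by (simp add: inverse_limit_ops)
  qed (use x in \<open>auto simp: inverse_limit_carrier inverse_limit_ops\<close>)
next
  fix y assume y: "\<And>n. y n \<in> L.filt n"
  obtain gs where gs: "\<aa> = Idl\<^bsub>R\<^esub> (set gs)" "set gs \<subseteq> carrier R"
    using assms unfolding finitely_generated_ideal_def by (metis finite_list)
  obtain s where s: "componentwise_sums y s"
    using componentwise_sums_exists[of y] y by blast
  \<comment> \<open>The remainder after k terms is the componentwise sum of the shifted series,
    whose n-th term lies in \<aa>^(k+n) L. Hence \<open>s\<close> is a sum in the \<aa>-adic sense
    of \<open>L\<close> itself.\<close>
  have "s \<ominus>\<^bsub>L\<^esub> partial_sum L y k \<in> L.filt k" for k
  proof (rule componentwise_sums_in_filt[OF gs])
    show "componentwise_sums (\<lambda>n. y (k + n)) (s \<ominus>\<^bsub>L\<^esub> partial_sum L y k)"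
      using L.filt_closed[OF y] s by (rule componentwise_sums_shift)
  qed (rule y)
  then show "\<exists>s. adic_sums R \<aa> L y s"
    using s by (auto simp: adic_sums_def componentwise_sums_def)
qed

end

theorem corollary0p4:
  fixes A :: "('a, 'r) ring_scheme" and \<aa> :: "'a set"
    and I :: "'i set" and r :: "('i \<times> 'i) set"
    and M :: "'i \<Rightarrow> ('a, 'm, 'x) module_scheme"
    and f :: "'i \<Rightarrow> 'i \<Rightarrow> 'm \<Rightarrow> 'm"
  assumes "cring A" and "ideal \<aa> A" and "finitely_generated_ideal A \<aa>"
    and "directed_set I r" and "inverse_system A I r M f"
    and "\<And>i. i \<in> I \<Longrightarrow> adically_complete A \<aa> (M i)"
  shows "adically_complete A \<aa> (inverse_limit I r M f)"
proof -
  interpret complete_system A I r M f \<aa>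
    using assms by (intro complete_system.intro complete_system_axioms.intro)
  show ?thesis
    by (rule inverse_limit_complete) fact
qed

end
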